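(* The Diophantine problem for orientable quadratic equations over the lamplighter group $L_2$ is decidable in linear time. That is, there is a linear-time algorithm which, given an integer $g\ge 1$ and words $c_1,\dots,c_k$ ($k\ge 0$) in the alphabet $\{a^{\pm1},t^{\pm1}\}$, decides whether there exist $x_1,y_1,\dots,x_g,y_g,z_1,\dots,z_k\in L_2$ with $$\prod_{i=1}^g[x_i,y_i]\prod_{j=1}^k z_j^{-1}c_jz_j=1 \quad\text{in } L_2.$$
   Context: Let $\mathbb{Z}_2^{\mathbb{Z}}$ denote the abelian group of finitely supported functions $f:\mathbb{Z}\to\mathbb{Z}_2$ under pointwise addition, and for $b\in\mathbb{Z}$ put $f^b(x)=f(x+b)$. The lamplighter group is $L_2=\mathbb{Z}\ltimes\mathbb{Z}_2^{\mathbb{Z}}$, the set of pairs $(\delta,f)$ with product $(\delta_1,f_1)(\delta_2,f_2)=(\delta_1+\delta_2,\,f_1^{\delta_2}+f_2)$. It is generated by $a=(0,\mathbf 1_0)$, where $\mathbf 1_0$ is the indicator function of $\{0\}$, and $t=(1,0)$. Elements of $L_2$ are given as words in $a^{\pm1},t^{\pm1}$. The model of computation is a random-access machine; integers are given in unary. The size of the input is the length of the left-hand side of the equation. Commutators are $[x,y]=x^{-1}y^{-1}xy$. *)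

theory Defs
  imports "HOL-Algebra.Group" "HOL-Library.Z2"
begin

section \<open>The lamplighter group\<close>

type_synonym lamp = "int \<times> (int \<Rightarrow> bit)"

definition lamplighter :: "lamp monoid" where
  "lamplighter =
    \<lparr>carrier = {(\<delta>, f). finite {x. f x \<noteq> 0}},
     mult = (\<lambda>(\<delta>\<^sub>1, f\<^sub>1) (\<delta>\<^sub>2, f\<^sub>2). (\<delta>\<^sub>1 + \<delta>\<^sub>2, \<lambda>x. f\<^sub>1 (x + \<delta>\<^sub>2) + f\<^sub>2 x)),
     one = (0, \<lambda>x. 0)\<rparr>"

lemma finite_shift: "finite {x::int. f x \<noteq> (0::bit)} \<Longrightarrow> finite {x. f (x + b) \<noteq> 0}"
proof -
  assume "finite {x. f x \<noteq> 0}"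
  moreover have "{x. f (x + b) \<noteq> 0} \<subseteq> (\<lambda>x. x - b) ` {x. f x \<noteq> 0}"
    by (auto simp: image_iff intro!: exI[of _ "_ + b"])
  ultimately show ?thesis
    by (meson finite_imageI finite_subset)
qed

lemma group_lamplighter: "group lamplighter"
proof (rule groupI)
  fix u v
  assume "u \<in> carrier lamplighter" "v \<in> carrier lamplighter"
  moreover obtain a f b h where "u = (a, f)" "v = (b, h)"
    by fastforce
  moreover have "{x. f (x + b) + h x \<noteq> 0} \<subseteq> {x. f (x + b) \<noteq> 0} \<union> {x. h x \<noteq> 0}"
    by auto
  ultimately show "u \<otimes>\<^bsub>lamplighter\<^esub> v \<in> carrier lamplighter"
    using finite_subset[of "{x. f (x + b) + h x \<noteq> 0}"] finite_shift[of f b]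
    by (simp add: lamplighter_def)
next
  fix u
  assume u: "u \<in> carrier lamplighter"
  obtain a f where "u = (a, f)"
    by fastforce
  then show "\<exists>v\<in>carrier lamplighter. v \<otimes>\<^bsub>lamplighter\<^esub> u = \<one>\<^bsub>lamplighter\<^esub>"
    using u finite_shift[of f "- a"]
    by (intro bexI[of _ "(- a, \<lambda>x. f (x + - a))"]) (simp_all add: lamplighter_def del: add_bit_eq_xor)
qed (auto simp: lamplighter_def algebra_simps simp del: add_bit_eq_xor)

datatype letter = A | A_inv | T | T_inv

definition lamp_a :: lamp where
  "lamp_a = (0, \<lambda>x. if x = 0 then 1 else 0)"

definition lamp_t :: lamp where
  "lamp_t = (1, \<lambda>x. 0)"

fun letter_value :: "letter \<Rightarrow> lamp" where
  "letter_value A = lamp_a"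
| "letter_value A_inv = inv\<^bsub>lamplighter\<^esub> lamp_a"
| "letter_value T = lamp_t"
| "letter_value T_inv = inv\<^bsub>lamplighter\<^esub> lamp_t"

text \<open>Products of lists are taken from left to right.\<close>

definition list_product :: "('a, 'b) monoid_scheme \<Rightarrow> 'a list \<Rightarrow> 'a" where
  "list_product G us = foldr (mult G) us \<one>\<^bsub>G\<^esub>"

definition word_value :: "letter list \<Rightarrow> lamp" where
  "word_value w = list_product lamplighter (map letter_value w)"

lemma letter_value_closed: "letter_value l \<in> carrier lamplighter"
proof -
  have "lamp_a \<in> carrier lamplighter" "lamp_t \<in> carrier lamplighter"
    by (simp_all add: lamplighter_def lamp_a_def lamp_t_def)
  then show ?thesis
    by (cases l) (simp_all add: group.inv_closed[OF group_lamplighter])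
qed


section \<open>Orientable quadratic equations\<close>

definition commutator :: "('a, 'b) monoid_scheme \<Rightarrow> 'a \<Rightarrow> 'a \<Rightarrow> 'a" where
  "commutator G x y = inv\<^bsub>G\<^esub> x \<otimes>\<^bsub>G\<^esub> inv\<^bsub>G\<^esub> y \<otimes>\<^bsub>G\<^esub> x \<otimes>\<^bsub>G\<^esub> y"

definition orientable_solvable :: "('a, 'b) monoid_scheme \<Rightarrow> nat \<Rightarrow> 'a list \<Rightarrow> bool" where
  "orientable_solvable G g cs \<longleftrightarrow>
    (\<exists>x y z :: nat \<Rightarrow> 'a.
      (\<forall>i<g. x i \<in> carrier G \<and> y i \<in> carrier G) \<and>
      (\<forall>j<length cs. z j \<in> carrier G) \<and>
      list_product G (map (\<lambda>i. commutator G (x i) (y i)) [0..<g]) \<otimes>\<^bsub>G\<^esub>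
      list_product G (map (\<lambda>j. inv\<^bsub>G\<^esub> (z j) \<otimes>\<^bsub>G\<^esub> cs ! j \<otimes>\<^bsub>G\<^esub> z j) [0..<length cs]) = \<one>\<^bsub>G\<^esub>)"

text \<open>An equation is given by its genus \<open>g\<close> and its list of coefficient words. A commutator
  contributes four letters to the left-hand side, a factor \<open>z\<inverse> c z\<close> contributes \<open>length c + 2\<close>.\<close>

type_synonym equation = "nat \<times> letter list list"

fun equation_size :: "equation \<Rightarrow> nat" where
  "equation_size (g, cs) = 4 * g + (\<Sum>c\<leftarrow>cs. length c + 2)"

text \<open>Input symbols: \<open>1\<close> is a unary digit of \<open>g\<close>, and \<open>2\<close> marks the beginning of a coefficient.\<close>

fun letter_code :: "letter \<Rightarrow> int" where
  "letter_code A = 3"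
| "letter_code A_inv = 4"
| "letter_code T = 5"
| "letter_code T_inv = 6"

fun encode_equation :: "equation \<Rightarrow> int list" where
  "encode_equation (g, cs) = replicate g 1 @ concat (map (\<lambda>c. 2 # map letter_code c) cs)"

lemma length_encode_equation: "length (encode_equation e) \<le> equation_size e"
proof -
  have "length (concat (map (\<lambda>c. 2 # map letter_code c) cs)) \<le> (\<Sum>c\<leftarrow>cs. length c + 2)" for cs
    by (induction cs) auto
  then show ?thesis
    by (cases e) (simp add: trans_le_add2 add_le_mono)
qed


section \<open>Random-access machines\<close>

text \<open>The machine of Cook and Reckhow: integer registers \<open>X 0, X 1, \<dots>\<close>, all initially \<open>0\<close>,
  addition, subtraction, indirect addressing, conditional jumps, and a one-way read-only input
  tape. Instead of printing its answer, the machine halts with it.\<close>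

datatype instruction =
    Load_Const nat int          \<comment> \<open>\<open>X i := c\<close>\<close>
  | Add nat nat nat             \<comment> \<open>\<open>X i := X j + X k\<close>\<close>
  | Sub nat nat nat             \<comment> \<open>\<open>X i := X j - X k\<close>\<close>
  | Load_Indirect nat nat       \<comment> \<open>\<open>X i := X (X j)\<close>\<close>
  | Store_Indirect nat nat      \<comment> \<open>\<open>X (X i) := X j\<close>\<close>
  | Jump_Pos nat nat            \<comment> \<open>go to instruction \<open>m\<close> if \<open>X j > 0\<close>\<close>
  | Read nat                    \<comment> \<open>\<open>X i :=\<close> next input symbol\<close>
  | Halt bool

type_synonym config = "nat \<times> (nat \<Rightarrow> int) \<times> int list"

text \<open>A configuration consists of the program counter, the registers and the unread input.
  Reading past the end of the input yields \<open>0\<close>. Without an executable instruction (after halting,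
  outside the program, or at a negative indirect address) the configuration no longer changes;
  only the first of these counts as halting.\<close>

fun ram_step :: "instruction list \<Rightarrow> config \<Rightarrow> config" where
  "ram_step P (pc, X, inp) =
    (if pc \<ge> length P then (pc, X, inp) else
     case P ! pc of
       Load_Const i c \<Rightarrow> (pc + 1, X(i := c), inp)
     | Add i j k \<Rightarrow> (pc + 1, X(i := X j + X k), inp)
     | Sub i j k \<Rightarrow> (pc + 1, X(i := X j - X k), inp)
     | Load_Indirect i j \<Rightarrow>
         if X j < 0 then (pc, X, inp) else (pc + 1, X(i := X (nat (X j))), inp)
     | Store_Indirect i j \<Rightarrow>
         if X i < 0 then (pc, X, inp) else (pc + 1, X(nat (X i) := X j), inp)
     | Jump_Pos m j \<Rightarrow> (if X j > 0 then m else pc + 1, X, inp)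
     | Read i \<Rightarrow>
         (case inp of [] \<Rightarrow> (pc + 1, X(i := 0), []) | s # inp' \<Rightarrow> (pc + 1, X(i := s), inp'))
     | Halt b \<Rightarrow> (pc, X, inp))"

definition ram_run :: "instruction list \<Rightarrow> int list \<Rightarrow> nat \<Rightarrow> config" where
  "ram_run P inp t = (ram_step P ^^ t) (0, \<lambda>_. 0, inp)"

definition halted_with :: "instruction list \<Rightarrow> config \<Rightarrow> bool \<Rightarrow> bool" where
  "halted_with P C b \<longleftrightarrow> fst C < length P \<and> P ! fst C = Halt b"

text \<open>Every instruction costs one unit of time. So that this is realistic, the registers must hold
  words of \<open>O(log n)\<close> bits throughout, that is, integers bounded by a polynomial in the input
  size \<open>n\<close>. The program and the constants do not depend on the instance.\<close>

definition linear_time_decidable ::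
  "('a \<Rightarrow> int list) \<Rightarrow> ('a \<Rightarrow> nat) \<Rightarrow> 'a set \<Rightarrow> ('a \<Rightarrow> bool) \<Rightarrow> bool" where
  "linear_time_decidable encode input_size D Q \<longleftrightarrow>
    (\<exists>(P :: instruction list) (c :: nat) (d :: nat). \<forall>e\<in>D. \<exists>t \<le> c * (input_size e + 1).
      halted_with P (ram_run P (encode e) t) (Q e) \<and>
      (\<forall>s\<le>t. \<forall>i. \<bar>fst (snd (ram_run P (encode e) s)) i\<bar> \<le> int (c * (input_size e + 1) ^ d)))"

end

theory Submission
  imports Defs "HOL-Library.Product_Plus"
begin

text \<open>Every \<open>(0, f)\<close> with \<open>f\<close> of even weight is a single commutator \<open>[(0, h), t]\<close>: this amounts to
  \<open>f x = h x + h (x + 1)\<close>, which the tail sums of \<open>f\<close> satisfy, and they are finitely supported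
  because the total of \<open>f\<close> vanishes. Hence for \<open>g \<ge> 1\<close> the commutators contribute an arbitrary
  element of the derived subgroup, and the equation is solvable if and only if the product of the
  coefficients is trivial in the abelianization \<open>\<int> \<times> \<int>\<^sub>2\<close>. A single pass over the input, with one
  counter for the exponent of \<open>t\<close> and one bit for the parity of the number of letters \<open>a\<close>,
  decides this.\<close>

section \<open>The abelianization of the lamplighter group\<close>

text \<open>The sum runs over the support because \<open>sum\<close> over an infinite index set is 0
  by convention.\<close>

definition lamp_total :: "(int \<Rightarrow> bit) \<Rightarrow> bit" where
  "lamp_total f = (\<Sum>x | f x \<noteq> 0. f x)"

lemma lamp_total_eq_sum:
  assumes "finite S" "{x. f x \<noteq> 0} \<subseteq> S"
  shows "lamp_total f = sum f S"
  unfolding lamp_total_def using assms by (intro sum.mono_neutral_left) auto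

lemma lamp_total_shift: "lamp_total (\<lambda>x. f (x + b)) = lamp_total f"
  unfolding lamp_total_def
  by (rule sum.reindex_bij_witness[of _ "\<lambda>x. x - b" "\<lambda>x. x + b"]) auto

lemma lamp_total_add:
  assumes "finite {x. f x \<noteq> 0}" "finite {x. h x \<noteq> 0}"
  shows "lamp_total (\<lambda>x. f x + h x) = lamp_total f + lamp_total h"
proof -
  let ?S = "{x. f x \<noteq> 0} \<union> {x. h x \<noteq> 0}"
  have "lamp_total (\<lambda>x. f x + h x) = (\<Sum>x\<in>?S. f x + h x)"
    using assms by (intro lamp_total_eq_sum) auto
  also have "\<dots> = sum f ?S + sum h ?S"
    by (rule sum.distrib)
  also have "\<dots> = lamp_total f + lamp_total h"
    using assms lamp_total_eq_sum[of ?S f] lamp_total_eq_sum[of ?S h] by simp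
  finally show ?thesis .
qed

text \<open>The abelianization map. Addition on the target pairs is componentwise.\<close>

definition lamp_abel :: "lamp \<Rightarrow> int \<times> bit" where
  "lamp_abel u = (fst u, lamp_total (snd u))"

text \<open>The product twists only by shifting the lamps, and a shift preserves the total.\<close>

lemma lamp_abel_mult:
  assumes "u \<in> carrier lamplighter" "v \<in> carrier lamplighter"
  shows "lamp_abel (u \<otimes>\<^bsub>lamplighter\<^esub> v) = lamp_abel u + lamp_abel v"
  using assms finite_shift[of "snd u" "fst v"]
  by (auto simp: lamp_abel_def lamplighter_def lamp_total_add lamp_total_shift
      simp del: add_bit_eq_xor)

section \<open>Elements with trivial abelianization are commutators\<close>

lemma even_lamps_eq_difference:
  assumes fin: "finite {x. f x \<noteq> 0}" and total: "lamp_total f = 0"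
  obtains h where "finite {x. h x \<noteq> 0}" "\<And>x. f x = h x + h (x + 1)"
proof
  define S where "S = {x. f x \<noteq> 0}"
  define h where "h x = sum f {y \<in> S. x \<le> y}" for x
  have "finite S"
    using fin by (simp add: S_def)
  show "f x = h x + h (x + 1)" for x
  proof (cases "x \<in> S")
    case True
    have "{y \<in> S. x \<le> y} = insert x {y \<in> S. x + 1 \<le> y}"
      using True by auto
    then have "h x = f x + h (x + 1)"
      using \<open>finite S\<close> by (simp add: h_def del: add_bit_eq_xor)
    then show ?thesis
      \<comment> \<open>The two copies of \<open>h (x + 1)\<close> cancel in characteristic
        2.\<close>
      by (simp add: add.assoc del: add_bit_eq_xor)
  next
    case False
    then have "{y \<in> S. x \<le> y} = {y \<in> S. x + 1 \<le> y}"
      by (auto simp: order_le_less)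
    then show ?thesis
      using False by (simp add: h_def S_def del: add_bit_eq_xor)
  qed
  \<comment> \<open>Take \<open>Min S\<close> and \<open>Max S\<close>; for empty \<open>S\<close>
    both bounds hold vacuously.\<close>
  obtain l u where lu: "\<And>y. y \<in> S \<Longrightarrow> l \<le> y" "\<And>y. y \<in> S \<Longrightarrow> y \<le> u"
    using \<open>finite S\<close> by (metis Max_ge Min_le)
  have "h x = 0" if "x \<notin> {l..u}" for x
  proof (cases "x < l")
    case True
    \<comment> \<open>Left of the support the tail sum is the whole total, which vanishes by
      assumption.\<close>
    then have "{y \<in> S. x \<le> y} = S"
      using lu by force
    then show ?thesis
      using total by (simp add: h_def lamp_total_def S_def)
  next
    case False
    then have "{y \<in> S. x \<le> y} = {}"
      using lu that by force
    then show ?thesis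
      by (simp add: h_def del: Collect_empty_eq)
  qed
  then have "{x. h x \<noteq> 0} \<subseteq> {l..u}"
    by blast
  then show "finite {x. h x \<noteq> 0}"
    using finite_subset by blast
qed

lemma lamp_commutator_exists:
  assumes "u \<in> carrier lamplighter" "lamp_abel u = 0"
  obtains x y where "x \<in> carrier lamplighter" "y \<in> carrier lamplighter"
    "commutator lamplighter x y = u"
proof -
  interpret group lamplighter
    by (rule group_lamplighter)
  obtain f where u: "u = (0, f)" and "finite {x. f x \<noteq> 0}" "lamp_total f = 0"
    using assms by (cases u) (auto simp: lamp_abel_def lamplighter_def zero_prod_def)
  then obtain h where h: "finite {x. h x \<noteq> 0}" "\<And>x. f x = h x + h (x + 1)"
    using even_lamps_eq_difference by metis
  have closed: "(0, h) \<in> carrier lamplighter" "lamp_t \<in> carrier lamplighter"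
    "(- 1, \<lambda>x. 0) \<in> carrier lamplighter"
    using h(1) by (simp_all add: lamplighter_def lamp_t_def)
  have "inv\<^bsub>lamplighter\<^esub> (0, h) = (0, h)"
    using closed by (intro inv_equality) (simp_all add: lamplighter_def del: add_bit_eq_xor)
  moreover have "inv\<^bsub>lamplighter\<^esub> lamp_t = (- 1, \<lambda>x. 0)"
    using closed by (intro inv_equality) (simp_all add: lamplighter_def lamp_t_def)
  \<comment> \<open>Here \<open>(0, h)\<close> is an involution and conjugation by
    \<open>lamp_t\<close> shifts \<open>h\<close> by one, so the commutator is the sum of
    \<open>h\<close> and its shift.\<close>
  ultimately have "commutator lamplighter (0, h) lamp_t = u"
    using h(2) by (auto simp: commutator_def lamplighter_def lamp_t_def u add.commute
        simp del: add_bit_eq_xor)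
  then show ?thesis
    using closed that by blast
qed


section \<open>Solvability in terms of the abelianization\<close>

lemma (in monoid) list_product_closed:
  "set us \<subseteq> carrier G \<Longrightarrow> list_product G us \<in> carrier G"
  by (induction us) (auto simp: list_product_def)

lemma (in monoid) list_product_ones:
  "set us \<subseteq> {\<one>} \<Longrightarrow> list_product G us = \<one>"
  by (induction us) (auto simp: list_product_def)

text \<open>The source is a multiplicative group with a carrier, the target an additive type class;
  hence the homomorphism law is spelled out.\<close>

locale hom_to_additive = group G for G (structure) +
  fixes \<phi> :: "'a \<Rightarrow> 'c::ab_group_add"
  assumes mult: "x \<in> carrier G \<Longrightarrow> y \<in> carrier G \<Longrightarrow> \<phi> (x \<otimes> y) = \<phi> x + \<phi> y"
begin

lemma one: "\<phi> \<one> = 0"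
  using mult[of \<one> \<one>] by simp

lemma inv: "x \<in> carrier G \<Longrightarrow> \<phi> (inv x) = - \<phi> x"
  using mult[of "inv x" x] by (simp add: one eq_neg_iff_add_eq_0)

lemma list_product:
  "set us \<subseteq> carrier G \<Longrightarrow> \<phi> (list_product G us) = sum_list (map \<phi> us)"
proof (induction us)
  case (Cons u us)
  then show ?case
    using list_product_closed[of us] by (simp add: list_product_def mult)
qed (simp add: list_product_def one)

lemma commutator:
  "x \<in> carrier G \<Longrightarrow> y \<in> carrier G \<Longrightarrow> \<phi> (commutator G x y) = 0"
  by (simp add: commutator_def mult inv)

text \<open>In an abelian image commutators vanish and conjugation has no effect, so only the
  coefficients survive.\<close>

lemma sum_list_eq_0_if_orientable_solvable:
  assumes cs: "set cs \<subseteq> carrier G" and "orientable_solvable G g cs"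
  shows "sum_list (map \<phi> cs) = 0"
proof -
  obtain x y z where
    xy: "\<And>i. i < g \<Longrightarrow> x i \<in> carrier G \<and> y i \<in> carrier G" and
    z: "\<And>j. j < length cs \<Longrightarrow> z j \<in> carrier G" and
    eq: "list_product G (map (\<lambda>i. commutator G (x i) (y i)) [0..<g]) \<otimes>
      list_product G (map (\<lambda>j. inv (z j) \<otimes> cs ! j \<otimes> z j) [0..<length cs]) = \<one>"
      (is "list_product G ?us \<otimes> list_product G ?vs = _")
    using assms(2) unfolding orientable_solvable_def by blast
  have c: "cs ! j \<in> carrier G" if "j < length cs" for j
    using that cs by (auto simp: subset_iff)
  have us: "set ?us \<subseteq> carrier G"
    using xy by (auto simp: commutator_def)
  have vs: "set ?vs \<subseteq> carrier G"
    using z c by auto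
  have "map \<phi> ?us = map (\<lambda>i. 0) [0..<g]"
    using xy by (simp add: commutator)
  then have "sum_list (map \<phi> ?us) = 0"
    by (metis sum_list_0)
  moreover have "map \<phi> ?vs = map (\<lambda>j. \<phi> (cs ! j)) [0..<length cs]"
    using z c by (simp add: mult inv)
  moreover have "map (\<lambda>j. \<phi> (cs ! j)) [0..<length cs] = map \<phi> cs"
    by (rule nth_equalityI) simp_all
  ultimately show ?thesis
    using arg_cong[OF eq, of \<phi>] us vs
    by (simp add: mult list_product_closed list_product one del: map_map)
qed

end

text \<open>With every \<open>z j\<close> trivial the coefficients multiply to
  \<open>list_product G cs\<close>; the first commutator, available as \<open>g \<ge> 1\<close>,
  cancels it, and the others are taken trivial.\<close>

lemma orientable_solvable_if_inv_commutator:
  assumes "group G" and cs: "set cs \<subseteq> carrier G" and "g \<ge> 1"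
    and xy: "x \<in> carrier G" "y \<in> carrier G"
    and eq: "commutator G x y = inv\<^bsub>G\<^esub> (list_product G cs)"
  shows "orientable_solvable G g cs"
proof -
  interpret group G by fact
  have c: "cs ! j \<in> carrier G" if "j < length cs" for j
    using that cs by (auto simp: subset_iff)
  have tail: "map (\<lambda>i. commutator G (if i = 0 then x else \<one>\<^bsub>G\<^esub>)
      (if i = 0 then y else \<one>\<^bsub>G\<^esub>)) [1..<g] = map (\<lambda>i. \<one>\<^bsub>G\<^esub>) [1..<g]"
    by (simp add: commutator_def)
  have "[0..<g] = 0 # [1..<g]"
    using \<open>g \<ge> 1\<close> by (simp add: upt_conv_Cons)
  then have "list_product G (map (\<lambda>i. commutator G (if i = 0 then x else \<one>\<^bsub>G\<^esub>)
      (if i = 0 then y else \<one>\<^bsub>G\<^esub>)) [0..<g]) =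
    commutator G x y \<otimes>\<^bsub>G\<^esub> list_product G (map (\<lambda>i. \<one>\<^bsub>G\<^esub>) [1..<g])"
    unfolding tail[symmetric] by (simp add: list_product_def)
  also have "\<dots> = inv\<^bsub>G\<^esub> (list_product G cs)"
    using cs by (subst list_product_ones) (auto simp: eq list_product_closed)
  finally have "list_product G (map (\<lambda>i. commutator G (if i = 0 then x else \<one>\<^bsub>G\<^esub>)
    (if i = 0 then y else \<one>\<^bsub>G\<^esub>)) [0..<g]) = \<dots>" .
  moreover have "map (\<lambda>j. inv\<^bsub>G\<^esub> \<one>\<^bsub>G\<^esub> \<otimes>\<^bsub>G\<^esub> cs ! j \<otimes>\<^bsub>G\<^esub> \<one>\<^bsub>G\<^esub>) [0..<length cs] = cs"
    using c by (intro nth_equalityI) simp_all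
  ultimately show ?thesis
    unfolding orientable_solvable_def using xy cs
    by (intro exI[of _ "\<lambda>i. if i = 0 then x else \<one>\<^bsub>G\<^esub>"] exI[of _ "\<lambda>i. if i = 0 then y else \<one>\<^bsub>G\<^esub>"]
        exI[of _ "\<lambda>j. \<one>\<^bsub>G\<^esub>"]) (simp add: list_product_closed l_inv)
qed

interpretation lamp_abel: hom_to_additive lamplighter lamp_abel
  by (intro hom_to_additive.intro group_lamplighter hom_to_additive_axioms.intro lamp_abel_mult)

text \<open>If the sum vanishes, the inverse of the product of \<open>cs\<close> has trivial
  abelianization and hence is a single commutator. The converse holds for any homomorphism into an
  abelian group.\<close>

lemma orientable_solvable_lamplighter_iff:
  assumes "g \<ge> 1" and cs: "set cs \<subseteq> carrier lamplighter"
  shows "orientable_solvable lamplighter g cs \<longleftrightarrow> sum_list (map lamp_abel cs) = 0"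
proof
  let ?p = "list_product lamplighter cs"
  assume "sum_list (map lamp_abel cs) = 0"
  then have "lamp_abel (inv\<^bsub>lamplighter\<^esub> ?p) = 0"
    using cs by (simp add: lamp_abel.inv lamp_abel.list_product lamp_abel.list_product_closed)
  then obtain x y where "x \<in> carrier lamplighter" "y \<in> carrier lamplighter"
    "commutator lamplighter x y = inv\<^bsub>lamplighter\<^esub> ?p"
    using lamp_commutator_exists cs
    by (metis lamp_abel.inv_closed lamp_abel.list_product_closed)
  then show "orientable_solvable lamplighter g cs"
    using orientable_solvable_if_inv_commutator[OF group_lamplighter cs \<open>g \<ge> 1\<close>] by blast
qed (rule lamp_abel.sum_list_eq_0_if_orientable_solvable[OF cs])

section \<open>Weights of the input symbols\<close>

definition symbol_weight :: "int \<Rightarrow> int \<times> bit" where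
  "symbol_weight s =
    (if s = 3 \<or> s = 4 then (0, 1) else if s = 5 then (1, 0) else if s = 6 then (- 1, 0) else 0)"

lemma lamp_abel_letter_value: "lamp_abel (letter_value l) = symbol_weight (letter_code l)"
proof -
  have "lamp_a \<in> carrier lamplighter" "lamp_t \<in> carrier lamplighter"
    using letter_value_closed[of A] letter_value_closed[of T] by simp_all
  moreover have "lamp_total (\<lambda>x. if x = 0 then 1 else 0) = 1"
    by (simp add: lamp_total_def)
  ultimately show ?thesis
    \<comment> \<open>Inverse letters become negatives before \<open>lamp_abel\<close> is unfolded;
      \<open>A\<close> and \<open>A_inv\<close> then agree because -1 = 1 modulo 2.\<close>
    by (cases l) (simp_all add: lamp_abel.inv, simp_all add: lamp_abel_def symbol_weight_def
      lamp_a_def lamp_t_def lamp_total_def)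
qed

lemma word_value_closed: "word_value w \<in> carrier lamplighter"
  unfolding word_value_def
  by (intro lamp_abel.list_product_closed) (auto simp: letter_value_closed)

lemma lamp_abel_word_value:
  "lamp_abel (word_value w) = (\<Sum>l\<leftarrow>w. symbol_weight (letter_code l))"
proof -
  have "set (map letter_value w) \<subseteq> carrier lamplighter"
    by (auto simp: letter_value_closed)
  then show ?thesis
    by (simp add: word_value_def lamp_abel.list_product lamp_abel_letter_value o_def)
qed

text \<open>Unary digits and coefficient markers weigh 0, so the machine can add up weights without
  tracking word boundaries.\<close>

lemma sum_list_symbol_weight_encode_equation:
  "(\<Sum>s\<leftarrow>encode_equation (g, cs). symbol_weight s) = (\<Sum>c\<leftarrow>cs. lamp_abel (word_value c))"
proof -
  have "symbol_weight 1 = 0" "symbol_weight 2 = 0"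
    by (simp_all add: symbol_weight_def)
  then have "(\<Sum>s\<leftarrow>replicate g 1. symbol_weight s) = 0"
    "(\<Sum>s\<leftarrow>concat (map (\<lambda>c. 2 # map letter_code c) cs). symbol_weight s) =
      (\<Sum>c\<leftarrow>cs. lamp_abel (word_value c))"
    by (induction g, simp_all) (induction cs, simp_all add: lamp_abel_word_value o_def)
  then show ?thesis
    by simp
qed


section \<open>The machine\<close>

text \<open>Couples the outcome of a run with the bound on all intermediate registers, so that both
  compose together.\<close>

definition bounded_run :: "instruction list \<Rightarrow> int \<Rightarrow> nat \<Rightarrow> config \<Rightarrow> config \<Rightarrow> bool" where
  "bounded_run P B t C C' \<longleftrightarrow> (ram_step P ^^ t) C = C' \<and>
    (\<forall>s\<le>t. \<forall>i. \<bar>fst (snd ((ram_step P ^^ s) C)) i\<bar> \<le> B)"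

lemma bounded_run_0:
  "bounded_run P B 0 C C' \<longleftrightarrow> C = C' \<and> (\<forall>i. \<bar>fst (snd C) i\<bar> \<le> B)"
  by (auto simp: bounded_run_def)

text \<open>Peels off the first step, which lets the simplifier execute the program
  symbolically.\<close>

lemma bounded_run_Suc:
  "bounded_run P B (Suc t) C C' \<longleftrightarrow>
    (\<forall>i. \<bar>fst (snd C) i\<bar> \<le> B) \<and> bounded_run P B t (ram_step P C) C'"
  by (simp add: bounded_run_def less_Suc_eq_le[symmetric] All_less_Suc2 funpow_swap1
      del: funpow.simps ram_step.simps add: funpow_Suc_right) blast

lemma bounded_run_numeral:
  "bounded_run P B (numeral k) C C' \<longleftrightarrow>
    (\<forall>i. \<bar>fst (snd C) i\<bar> \<le> B) \<and> bounded_run P B (pred_numeral k) (ram_step P C) C'"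
  by (simp add: numeral_eq_Suc bounded_run_Suc)

lemma bounded_run_trans:
  "bounded_run P B s C C' \<Longrightarrow> bounded_run P B t C' C'' \<Longrightarrow> bounded_run P B (s + t) C C''"
  by (induction s arbitrary: C) (simp_all add: bounded_run_0 bounded_run_Suc)

text \<open>Register 0 holds the current symbol, registers 1 and 2 the components of the partial sum
  of weights. Instruction 2 is the head of the loop, and a jump on register 3 is
  unconditional.\<close>

definition lamp_program :: "instruction list" where
  "lamp_program =
    [Load_Const 3 1,
     Load_Const 4 2,
     Read 0,
     Jump_Pos 10 0,
     Jump_Pos 9 1,
     Jump_Pos 9 2,
     Sub 1 5 1,
     Jump_Pos 9 1,
     Halt True,
     Halt False,
     Sub 0 0 4,
     Jump_Pos 13 0,
     Jump_Pos 2 3,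
     Sub 0 0 4,
     Jump_Pos 17 0,
     Sub 2 3 2,
     Jump_Pos 2 3,
     Sub 0 0 3,
     Jump_Pos 21 0,
     Add 1 1 3,
     Jump_Pos 2 3,
     Sub 1 1 3,
     Jump_Pos 2 3]"

lemma lamp_program_nth:
  "length lamp_program = 23"
  "lamp_program ! 0 = Load_Const 3 1"
  "lamp_program ! (Suc 0) = Load_Const 4 2"
  "lamp_program ! 2 = Read 0"
  "lamp_program ! 3 = Jump_Pos 10 0"
  "lamp_program ! 4 = Jump_Pos 9 1"
  "lamp_program ! 5 = Jump_Pos 9 2"
  "lamp_program ! 6 = Sub 1 5 1"
  "lamp_program ! 7 = Jump_Pos 9 1"
  "lamp_program ! 8 = Halt True"
  "lamp_program ! 9 = Halt False"
  "lamp_program ! 10 = Sub 0 0 4"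
  "lamp_program ! 11 = Jump_Pos 13 0"
  "lamp_program ! 12 = Jump_Pos 2 3"
  "lamp_program ! 13 = Sub 0 0 4"
  "lamp_program ! 14 = Jump_Pos 17 0"
  "lamp_program ! 15 = Sub 2 3 2"
  "lamp_program ! 16 = Jump_Pos 2 3"
  "lamp_program ! 17 = Sub 0 0 3"
  "lamp_program ! 18 = Jump_Pos 21 0"
  "lamp_program ! 19 = Add 1 1 3"
  "lamp_program ! 20 = Jump_Pos 2 3"
  "lamp_program ! 21 = Sub 1 1 3"
  "lamp_program ! 22 = Jump_Pos 2 3"
  by (simp_all add: lamp_program_def)

text \<open>Normal form of the registers inside the loop. Registers 3 and 4 keep the constants 1 and
  2; register 5 stays 0 and serves to negate register 1.\<close>

definition registers :: "int \<Rightarrow> int \<Rightarrow> int \<Rightarrow> nat \<Rightarrow> int" where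
  "registers x p q = (\<lambda>_. 0)(0 := x, 1 := p, 2 := q, 3 := 1, 4 := 2)"

lemma registers_nth:
  "registers x p q 0 = x" "registers x p q (Suc 0) = p" "registers x p q 2 = q"
  "registers x p q 3 = 1" "registers x p q 4 = 2" "registers x p q 5 = 0"
  by (simp_all add: registers_def)

lemma registers_upd:
  "(registers x p q)(0 := v) = registers v p q"
  "(registers x p q)(Suc 0 := v) = registers x v q"
  "(registers x p q)(2 := v) = registers x p v"
  by (auto simp: registers_def)

lemma registers_bounded:
  assumes "2 \<le> B" "\<bar>x\<bar> \<le> B" "\<bar>p\<bar> \<le> B" "\<bar>q\<bar> \<le> B"
  shows "\<bar>registers x p q i\<bar> \<le> B"
  using assms by (simp add: registers_def)

section \<open>Symbolic execution of the program\<close>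

lemmas lamp_program_run_simps = lamp_program_nth
  bounded_run_0 bounded_run_Suc bounded_run_numeral registers_nth registers_upd registers_bounded

text \<open>Jumps test only positivity, so the symbol is identified by subtracting 2, 2 and 1 in
  turn. The remainder \<open>x'\<close> is overwritten by the next \<open>Read\<close>; only its
  size matters.\<close>

lemma lamp_program_symbol:
  assumes "s \<in> {1..6}" "\<bar>fst v\<bar> + 6 < B" "\<bar>x\<bar> \<le> 6"
  obtains t x' where "t \<le> 10" "\<bar>x'\<bar> \<le> 6" "bounded_run lamp_program B t
    (2, registers x (fst v) (of_bit (snd v)), s # inp)
    (2, registers x' (fst (v + symbol_weight s)) (of_bit (snd (v + symbol_weight s))), inp)"
proof -
  obtain p q where v: "v = (p, q)"
    by fastforce
  have bounds: "2 \<le> B" "6 \<le> B" "\<bar>x\<bar> \<le> B" "\<bar>p\<bar> \<le> B" "\<bar>p + 1\<bar> \<le> B" "\<bar>p - 1\<bar> \<le> B"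
    using assms(2,3) by (simp_all add: v)
  have "s = 1 \<or> s = 2 \<or> s = 3 \<or> s = 4 \<or> s = 5 \<or> s = 6"
    using assms(1) by auto
  then consider "s \<in> {1, 2}" | "s \<in> {3, 4}" | "s = 5" | "s = 6"
    by blast
  then show ?thesis
  proof cases
    case 1
    then have "bounded_run lamp_program B 5 (2, registers x p (of_bit q), s # inp)
      (2, registers (s - 2) p (of_bit q), inp)"
      using bounds by (cases q; elim insertE emptyE) (simp_all add: lamp_program_run_simps)
    then show ?thesis
      using 1 by (intro that[of 5 "s - 2"]) (auto simp: v symbol_weight_def)
  next
    case 2
    \<comment> \<open>The parity flips through the integer subtraction 1 - q.\<close>
    then have "bounded_run lamp_program B 8 (2, registers x p (of_bit q), s # inp)
      (2, registers (s - 4) p (of_bit (q + 1)), inp)"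
      using bounds by (cases q; elim insertE emptyE) (simp_all add: lamp_program_run_simps)
    then show ?thesis
      using 2 by (intro that[of 8 "s - 4"]) (auto simp: v symbol_weight_def simp del: add_bit_eq_xor)
  next
    case 3
    then have "bounded_run lamp_program B 10 (2, registers x p (of_bit q), s # inp)
      (2, registers 0 (p + 1) (of_bit q), inp)"
      using bounds by (cases q) (simp_all add: lamp_program_run_simps)
    then show ?thesis
      using 3 by (intro that[of 10 0]) (auto simp: v symbol_weight_def)
  next
    case 4
    then have "bounded_run lamp_program B 10 (2, registers x p (of_bit q), s # inp)
      (2, registers 1 (p - 1) (of_bit q), inp)"
      using bounds by (cases q) (simp_all add: lamp_program_run_simps)
    then show ?thesis
      using 4 by (intro that[of 10 1]) (auto simp: v symbol_weight_def)
  qed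
qed

text \<open>\<open>Read\<close> yields 0 at the end of the input, which leads to the final tests.
  With positivity tests only, p = 0 is established by testing p and then -p.\<close>

lemma lamp_program_end:
  assumes "\<bar>fst v\<bar> + 6 < B" "\<bar>x\<bar> \<le> 6"
  obtains t C where "t \<le> 6"
    "bounded_run lamp_program B t (2, registers x (fst v) (of_bit (snd v)), []) C"
    "halted_with lamp_program C (v = 0)"
proof -
  obtain p q where v: "v = (p, q)"
    by fastforce
  have bounds: "2 \<le> B" "\<bar>x\<bar> \<le> B" "\<bar>p\<bar> \<le> B"
    using assms by (simp_all add: v)
  consider "p > 0" | "p \<le> 0" "q = 1" | "p < 0" "q = 0" | "p = 0" "q = 0"
    by (cases q) fastforce+
  then show ?thesis
  proof cases
    case 1
    then have "bounded_run lamp_program B 3 (2, registers x p (of_bit q), [])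
      (9, registers 0 p (of_bit q), [])"
      using bounds by (cases q) (simp_all add: lamp_program_run_simps)
    then show ?thesis
      using 1 by (intro that) (auto simp: v halted_with_def lamp_program_nth zero_prod_def)
  next
    case 2
    then have "bounded_run lamp_program B 4 (2, registers x p 1, []) (9, registers 0 p 1, [])"
      using bounds by (simp add: lamp_program_run_simps)
    then show ?thesis
      using 2 by (intro that[of 4]) (auto simp: v halted_with_def lamp_program_nth zero_prod_def)
  next
    case 3
    then have "bounded_run lamp_program B 6 (2, registers x p 0, []) (9, registers 0 (- p) 0, [])"
      using bounds by (simp add: lamp_program_run_simps)
    then show ?thesis
      using 3 by (intro that[of 6]) (auto simp: v halted_with_def lamp_program_nth zero_prod_def)
  next
    case 4
    then have "bounded_run lamp_program B 6 (2, registers x p 0, []) (8, registers 0 0 0, [])"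
      using bounds by (simp add: lamp_program_run_simps)
    then show ?thesis
      using 4 by (intro that[of 6]) (auto simp: v halted_with_def lamp_program_nth zero_prod_def)
  qed
qed

text \<open>Each symbol costs at most 10 steps and changes the counter by at most 1, so the counter
  plus the remaining length stays within the budget. The start values \<open>v\<close> and
  \<open>x\<close> are general for the induction.\<close>

lemma lamp_program_loop:
  assumes "set inp \<subseteq> {1..6}" "\<bar>fst v\<bar> + int (length inp) + 6 < B" "\<bar>x\<bar> \<le> 6"
  shows "\<exists>t C. t \<le> 10 * length inp + 6 \<and>
    bounded_run lamp_program B t (2, registers x (fst v) (of_bit (snd v)), inp) C \<and>
    halted_with lamp_program C (v + (\<Sum>s\<leftarrow>inp. symbol_weight s) = 0)"
  using assms
proof (induction inp arbitrary: v x)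
  case Nil
  then have "\<bar>fst v\<bar> + 6 < B"
    by simp
  then obtain t C where "t \<le> 6"
    "bounded_run lamp_program B t (2, registers x (fst v) (of_bit (snd v)), []) C"
    "halted_with lamp_program C (v = 0)"
    using lamp_program_end Nil.prems(3) by blast
  then show ?case
    by (intro exI[of _ t] exI[of _ C]) simp
next
  case (Cons s inp)
  let ?v = "v + symbol_weight s"
  obtain t x' where t: "t \<le> 10" "\<bar>x'\<bar> \<le> 6" "bounded_run lamp_program B t
    (2, registers x (fst v) (of_bit (snd v)), s # inp)
    (2, registers x' (fst ?v) (of_bit (snd ?v)), inp)"
    using lamp_program_symbol[of s v B x] Cons.prems by auto
  have "\<bar>fst (symbol_weight s)\<bar> \<le> 1"
    by (simp add: symbol_weight_def)
  then have "\<bar>fst ?v\<bar> + int (length inp) + 6 < B"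
    using Cons.prems(2) by (simp add: fst_add)
  then obtain t' C where "t' \<le> 10 * length inp + 6"
    "bounded_run lamp_program B t' (2, registers x' (fst ?v) (of_bit (snd ?v)), inp) C"
    "halted_with lamp_program C (?v + (\<Sum>s\<leftarrow>inp. symbol_weight s) = 0)"
    using Cons.IH[of ?v x'] Cons.prems t(2) by auto
  then show ?case
    using t(1) bounded_run_trans[OF t(3)]
    by (intro exI[of _ "t + t'"] exI[of _ C]) (auto simp: add.assoc)
qed

text \<open>All symbols are positive, so reading 0 unambiguously signals the end of the
  input.\<close>

lemma encode_equation_symbols: "set (encode_equation e) \<subseteq> {1..6}"
proof -
  have "letter_code l \<in> {1..6}" for l
    by (cases l) auto
  then show ?thesis
    by (cases e) (auto split: if_splits)
qed

theorem proposition4p2: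
  "linear_time_decidable encode_equation equation_size {(g, cs). g \<ge> 1}
     (\<lambda>(g, cs). orientable_solvable lamplighter g (map word_value cs))"
  unfolding linear_time_decidable_def
\<comment> \<open>For input size n, two initial steps and at most 10 n + 6 further ones fit into 10
  (n + 1); the same number exceeds n + 6, as the register bound requires.\<close>
proof (rule exI[of _ lamp_program], rule exI[of _ 10], rule exI[of _ 1], rule ballI)
  fix e :: equation
  assume "e \<in> {(g, cs). g \<ge> 1}"
  then obtain g cs where e: "e = (g, cs)" "g \<ge> 1"
    by blast
  let ?inp = "encode_equation e" and ?B = "int (10 * (equation_size e + 1) ^ 1)"
  let ?Q = "case e of (g, cs) \<Rightarrow> orientable_solvable lamplighter g (map word_value cs)"
  have Q: "?Q \<longleftrightarrow> (\<Sum>s\<leftarrow>?inp. symbol_weight s) = 0"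
    using orientable_solvable_lamplighter_iff[OF e(2), of "map word_value cs"]
    by (simp add: e(1) sum_list_symbol_weight_encode_equation image_subset_iff word_value_closed o_def
        del: encode_equation.simps)
  have len: "length ?inp \<le> equation_size e"
    by (rule length_encode_equation)
  then obtain t C where t: "t \<le> 10 * length ?inp + 6"
    "bounded_run lamp_program ?B t (2, registers 0 0 0, ?inp) C" "halted_with lamp_program C ?Q"
    using lamp_program_loop[of ?inp 0 ?B 0] encode_equation_symbols[of e] Q by auto
  \<comment> \<open>The two constant loads bring the zero registers into the normal form at the loop
    head.\<close>
  have "bounded_run lamp_program ?B 2 (0, \<lambda>_. 0, ?inp) (2, registers 0 0 0, ?inp)"
    by (auto simp: bounded_run_0 bounded_run_Suc bounded_run_numeral lamp_program_def registers_def)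
  from bounded_run_trans[OF this t(2)]
  have "bounded_run lamp_program ?B (2 + t) (0, \<lambda>_. 0, ?inp) C" .
  then show "\<exists>t\<le>10 * (equation_size e + 1).
      halted_with lamp_program (ram_run lamp_program ?inp t) ?Q \<and>
      (\<forall>s\<le>t. \<forall>i. \<bar>fst (snd (ram_run lamp_program ?inp s)) i\<bar> \<le> ?B)"
    using t len unfolding bounded_run_def ram_run_def by (intro exI[of _ "2 + t"]) auto
qed

end
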